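(* Let $n$ be an even positive integer, let $m = n/2$, and let $T = \sqrt{-n\log(0.05)}$. Let $|f_0|,|f_1|,\dots,|f_{m-1}|$ be nonnegative real random variables, and assume that the random vector $\left(|f_0|^2,|f_1|^2,\dots,|f_{m-1}|^2\right)$ is restricted to the surface in $\mathbb{R}^m$ defined by $$\sum_{j=0}^{m-1}|f_j|^2 = 2m^2$$ and is uniformly distributed in the area of this surface where $|f_j|^2\ge 0$ for $j=0,1,\dots,m-1$. For $j=0,1,\dots,m-1$ let $F_j = 1$ if $|f_j|\le T$ and $F_j=0$ if $|f_j|>T$, and let $N_1=\sum_{j=0}^{m-1}F_j$. Then the variance of $N_1$ is $$V[N_1] = m\left\{\left(1-\frac{T^2}{2m^2}\right)^{m-1}-\left(1-\frac{T^2}{2m^2}\right)^{2m-2}\right\} + m(m-1)\left\{\left(1-\frac{T^2}{m^2}\right)^{m-1}-\left(1-\frac{T^2}{2m^2}\right)^{2m-2}\right\}.$$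
   Context: Here $\log$ is the natural logarithm and $V[\cdot]$ denotes variance. The random variables $|f_j|$ model the discrete Fourier spectrum of a random $\pm1$ sequence of length $n$, that is, $|f_j|$ stands for the modulus of $\sum_{k=0}^{n-1}x_k e^{2\pi i kj/n}$ with $x_k=\pm1$; $N_1$ is the number of spectrum values not exceeding the threshold $T$. The joint law of the $|f_j|^2$ given in the claim is an assumption, not a derived property of random sequences.
   Formalization: The values n = 4, 6, 8, 10 are excluded, because there T² > m² and the printed variance formula is false (for n = 4, N₁ = 2 almost surely, so its variance is 0, while the formula gives about −5.98); n = 2 and all even n ≥ 12 are kept. *)

theory Defs
  imports "HOL-Probability.Probability"
begin

(* The d-dimensional Hausdorff (outer) measure on a metric space, d a natural number, with the
   factor unit_ball_vol d / 2^d that makes it the usual d-dimensional area on d-dimensional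
   planes of a Euclidean space.  For d = 0 every nonempty set has weight 1, so that the
   0-dimensional measure counts points.  Boundedness is demanded of the covering sets because
   diameter is a supremum of reals, hence meaningless on unbounded sets. *)

definition diameter_power :: "nat \<Rightarrow> 'b::metric_space set \<Rightarrow> ennreal" where
  "diameter_power d E = (if E = {} then 0 else ennreal (diameter E ^ d))"

definition fine_covers :: "real \<Rightarrow> 'b::metric_space set \<Rightarrow> (nat \<Rightarrow> 'b set) set" where
  "fine_covers \<delta> A =
     {C. A \<subseteq> (\<Union>i. C i) \<and> (\<forall>i. bounded (C i) \<and> diameter (C i) \<le> \<delta>)}"

definition hausdorff_measure :: "nat \<Rightarrow> 'b::metric_space set \<Rightarrow> ennreal" where
  "hausdorff_measure d A =
     ennreal (unit_ball_vol (real d) / 2 ^ d) *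
     (SUP \<delta>\<in>{0<..}. INF C\<in>fine_covers \<delta> A. \<Sum>i. diameter_power d (C i))"

(* Uniform distribution on a d-dimensional surface S with respect to d-dimensional area.
   Taking A = UNIV shows that on a probability space the condition entails
   0 < hausdorff_measure d S < \<infinity>; taking A = - S, that X lies in S almost surely
   whenever S is Borel. *)

definition uniformly_distributed_on_surface ::
    "'a measure \<Rightarrow> ('a \<Rightarrow> 'b::metric_space) \<Rightarrow> nat \<Rightarrow> 'b set \<Rightarrow> bool" where
  "uniformly_distributed_on_surface M X d S \<longleftrightarrow>
     X \<in> borel_measurable M \<and>
     (\<forall>A\<in>sets borel.
        emeasure M (X -` A \<inter> space M) = hausdorff_measure d (A \<inter> S) / hausdorff_measure d S)"

(* The part in the closed nonnegative orthant of the hyperplane where the coordinates sum to c;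
   its dimension is CARD('m) - 1. *)

definition nonneg_sum_surface :: "real \<Rightarrow> (real ^ 'm) set" where
  "nonneg_sum_surface c = {y. (\<Sum>j\<in>UNIV. y $ j) = c \<and> (\<forall>j. 0 \<le> y $ j)}"

end

(* The corner of the simplex where the coordinates in J are at least t is the image of the whole
   simplex under a similarity x |-> a + r x with r = 1 - |J| t / c.  A similarity of ratio r
   multiplies d-dimensional Hausdorff measure by r^d, so the corner has probability r^d, and no
   absolute value of the area is needed.  With |J| = 1, 2 this gives the first two moments of the
   number of coordinates exceeding T^2. *)

theory Submission
  imports Defs
begin

section \<open>Hausdorff measure under Lipschitz maps and similarities\<close>

lemma dist_lipschitz_le_diameter:
  fixes f :: "'a::metric_space \<Rightarrow> 'b::metric_space"
  assumes "L-lipschitz_on E f" "bounded E" "x \<in> E" "y \<in> E"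
  shows "dist (f x) (f y) \<le> L * diameter E"
proof -
  have "dist (f x) (f y) \<le> L * dist x y"
    using assms(1,3,4) by (rule lipschitz_onD)
  also have "\<dots> \<le> L * diameter E"
    using assms by (intro mult_left_mono diameter_bounded_bound lipschitz_on_nonneg)
  finally show ?thesis .
qed

lemma diameter_lipschitz_image_le:
  fixes f :: "'a::metric_space \<Rightarrow> 'b::metric_space"
  assumes "L-lipschitz_on E f" "bounded E"
  shows "diameter (f ` E) \<le> L * diameter E"
proof (cases "E = {}")
  case False
  then show ?thesis
    using dist_lipschitz_le_diameter [OF assms]
    by (auto simp: diameter_def [of "f ` E"] intro!: cSUP_least)
qed simp

lemma bounded_lipschitz_image:
  fixes f :: "'a::metric_space \<Rightarrow> 'b::metric_space"
  assumes "L-lipschitz_on E f" "bounded E"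
  shows "bounded (f ` E)"
  using dist_lipschitz_le_diameter [OF assms] by (auto simp: bounded_two_points)

text \<open>Images of the members of a \<open>\<delta> / L\<close>-fine cover of \<open>A\<close>
  form a \<open>\<delta>\<close>-fine cover of the image, and each diameter grows by a factor of at
  most \<open>L\<close>.\<close>

lemma hausdorff_measure_lipschitz_image_le:
  fixes f :: "'a::metric_space \<Rightarrow> 'b::metric_space"
  assumes lip: "L-lipschitz_on A f" and "0 < L"
  shows "hausdorff_measure d (f ` A) \<le> ennreal (L ^ d) * hausdorff_measure d A"
proof -
  \<comment> \<open>\<open>h\<close> and \<open>h'\<close> are the same infimum; it is named twice
    because a local definition has a single type and the source and target spaces differ.\<close>
  define h where "h B \<delta> = (INF C\<in>fine_covers \<delta> B. \<Sum>i. diameter_power d (C i))"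
    for B :: "'a set" and \<delta>
  define h' where "h' B \<delta> = (INF C\<in>fine_covers \<delta> B. \<Sum>i. diameter_power d (C i))"
    for B :: "'b set" and \<delta>
  have cancel: "ennreal (L ^ d) * (ennreal ((1 / L) ^ d) * x) = x" for x
    using \<open>0 < L\<close>
    by (simp add: mult.assoc [symmetric] ennreal_mult' [symmetric] power_mult_distrib [symmetric])
  have sum_le: "h' (f ` A) \<delta> \<le> ennreal (L ^ d) * (\<Sum>i. diameter_power d (C i))"
    if C: "C \<in> fine_covers (\<delta> / L) A" for C \<delta>
  proof -
    \<comment> \<open>Covering sets may stick out of \<open>A\<close>, where \<open>f\<close> need
      not be Lipschitz, so they are cut down to \<open>A\<close> before being mapped.\<close>
    let ?D = "\<lambda>i. C i \<inter> A"
    have bdd: "bounded (C i)" and diam: "diameter (C i) \<le> \<delta> / L" for i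
      using C by (auto simp: fine_covers_def)
    have lipD: "L-lipschitz_on (?D i) f" for i
      using lip by (rule lipschitz_on_subset) auto
    have bddD: "bounded (?D i)" for i
      using bdd by (meson bounded_subset inf_le1)
    have diam_le: "diameter (f ` ?D i) \<le> L * diameter (C i)" for i
      using diameter_lipschitz_image_le [OF lipD bddD] diameter_subset [OF _ bdd, of "?D i" i]
        \<open>0 < L\<close> by (meson inf_le1 less_imp_le mult_left_mono order_trans)
    have "(\<lambda>i. f ` ?D i) \<in> fine_covers \<delta> (f ` A)"
    proof -
      have "diameter (f ` ?D i) \<le> \<delta>" for i
        using diam_le [of i] diam [of i] \<open>0 < L\<close> by (simp add: field_simps)
      moreover have "f ` A \<subseteq> (\<Union>i. f ` ?D i)"
        using C by (fastforce simp: fine_covers_def)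
      ultimately show ?thesis
        using bounded_lipschitz_image [OF lipD bddD] by (simp add: fine_covers_def)
    qed
    then have "h' (f ` A) \<delta> \<le> (\<Sum>i. diameter_power d (f ` ?D i))"
      unfolding h'_def by (rule INF_lower)
    also have "\<dots> \<le> (\<Sum>i. ennreal (L ^ d) * diameter_power d (C i))"
    proof (intro suminf_le summableI)
      fix i
      have "diameter (f ` ?D i) ^ d \<le> (L * diameter (C i)) ^ d"
        using diam_le bounded_lipschitz_image [OF lipD bddD]
        by (intro power_mono diameter_ge_0)
      then show "diameter_power d (f ` ?D i) \<le> ennreal (L ^ d) * diameter_power d (C i)"
        using \<open>0 < L\<close> diameter_ge_0 [OF bdd, of i]
        by (auto simp: diameter_power_def ennreal_mult [symmetric] power_mult_distrib
            intro!: ennreal_leI)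
    qed
    finally show ?thesis by simp
  qed
  have "h' (f ` A) \<delta> \<le> ennreal (L ^ d) * h A (\<delta> / L)" for \<delta>
  proof -
    \<comment> \<open>The factor \<open>L ^ d\<close> is moved to the left side as its inverse, so
      that the right side is a plain infimum and it suffices to bound every cover;
      \<open>cancel\<close> moves it back.\<close>
    have "ennreal ((1 / L) ^ d) * h' (f ` A) \<delta> \<le> h A (\<delta> / L)"
      unfolding h_def
    proof (rule INF_greatest)
      fix C assume "C \<in> fine_covers (\<delta> / L) A"
      from mult_left_mono [OF sum_le [OF this], of "ennreal ((1 / L) ^ d)"]
      show "ennreal ((1 / L) ^ d) * h' (f ` A) \<delta> \<le> (\<Sum>i. diameter_power d (C i))"
        using cancel by (simp add: mult.left_commute)
    qed
    from mult_left_mono [OF this, of "ennreal (L ^ d)"] show ?thesis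
      by (simp add: cancel)
  qed
  moreover have "h A (\<delta> / L) \<le> (SUP \<delta>\<in>{0<..}. h A \<delta>)" if "0 < \<delta>" for \<delta>
    using that \<open>0 < L\<close> by (intro SUP_upper) auto
  ultimately have "(SUP \<delta>\<in>{0<..}. h' (f ` A) \<delta>) \<le> ennreal (L ^ d) * (SUP \<delta>\<in>{0<..}. h A \<delta>)"
    by (intro SUP_least) (meson greaterThan_iff mult_left_mono order_trans zero_le)
  from mult_left_mono [OF this, of "ennreal (unit_ball_vol (real d) / 2 ^ d)"] show ?thesis
    unfolding hausdorff_measure_def h_def h'_def by (simp add: mult.left_commute)
qed

text \<open>The map is \<open>r\<close>-Lipschitz and its inverse is \<open>1 / r\<close>-Lipschitz,
  so the Lipschitz bound applies in both directions.\<close>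

lemma hausdorff_measure_similarity:
  fixes a :: "'a::real_normed_vector"
  assumes "0 < r"
  shows "hausdorff_measure d ((\<lambda>x. a + r *\<^sub>R x) ` A) = ennreal (r ^ d) * hausdorff_measure d A"
proof (rule antisym)
  have lip: "s-lipschitz_on B (\<lambda>x. b + s *\<^sub>R x)" if "0 < s" for s and b :: 'a and B
    using that by (intro lipschitz_onI) (auto simp: dist_norm scaleR_diff_right [symmetric])
  show "hausdorff_measure d ((\<lambda>x. a + r *\<^sub>R x) ` A) \<le> ennreal (r ^ d) * hausdorff_measure d A"
    using assms lip by (intro hausdorff_measure_lipschitz_image_le)
  let ?B = "(\<lambda>x. a + r *\<^sub>R x) ` A"
  let ?g = "\<lambda>x. - (1 / r) *\<^sub>R a + (1 / r) *\<^sub>R x"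
  have "?g ` ?B = A"
    using assms by (auto simp: image_image scaleR_add_right)
  then have "hausdorff_measure d A \<le> ennreal ((1 / r) ^ d) * hausdorff_measure d ?B"
    using hausdorff_measure_lipschitz_image_le
        [of "1 / r" ?B "\<lambda>x. - (1 / r) *\<^sub>R a + (1 / r) *\<^sub>R x" d, OF lip] assms
    by simp
  from mult_left_mono [OF this, of "ennreal (r ^ d)"]
  show "ennreal (r ^ d) * hausdorff_measure d A \<le> hausdorff_measure d ?B"
    using assms
    by (simp add: mult.assoc [symmetric] ennreal_mult' [symmetric] power_mult_distrib [symmetric])
qed

section \<open>Corners of the simplex\<close>

text \<open>Subtracting \<open>t\<close> from the coordinates in \<open>J\<close> leaves nonnegative
  coordinates with sum \<open>c - card J * t\<close>, which is \<open>r * c\<close>; dividing by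
  \<open>r\<close> restores the sum \<open>c\<close>.\<close>

lemma nonneg_sum_surface_corner:
  fixes J :: "'m::finite set"
  assumes "0 \<le> t" "real (card J) * t < c"
  defines "r \<equiv> 1 - real (card J) * t / c"
  shows "{y. \<forall>j\<in>J. t \<le> y $ j} \<inter> nonneg_sum_surface c =
    (\<lambda>x. (\<chi> j. if j \<in> J then t else 0) + r *\<^sub>R x) ` nonneg_sum_surface c"
    (is "?L = ?f ` ?S")
proof -
  have "0 < c"
    using assms(1,2) by (meson le_less_trans mult_nonneg_nonneg of_nat_0_le_iff)
  then have r: "0 < r" and rc: "r * c = c - real (card J) * t"
    using assms(2) by (simp_all add: r_def field_simps)
  let ?a = "\<chi> j. if j \<in> J then t else 0"
  have sum_a: "(\<Sum>j\<in>UNIV. ?a $ j) = real (card J) * t"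
    by (simp add: sum.If_cases)
  show ?thesis
  proof (intro equalityI subsetI)
    fix y assume y: "y \<in> ?L"
    let ?x = "(1 / r) *\<^sub>R (y - ?a)"
    have "(\<Sum>j\<in>UNIV. ?x $ j) = (1 / r) * ((\<Sum>j\<in>UNIV. y $ j) - (\<Sum>j\<in>UNIV. ?a $ j))"
      by (simp add: sum_distrib_left sum_subtractf right_diff_distrib diff_divide_distrib sum_divide_distrib)
    also have "\<dots> = c"
      using y r unfolding sum_a by (simp add: nonneg_sum_surface_def rc [symmetric])
    finally have "?x \<in> ?S"
      using y r by (auto simp: nonneg_sum_surface_def)
    moreover have "y = ?f ?x"
      using r by simp
    ultimately show "y \<in> ?f ` ?S"
      by blast
  next
    fix y assume "y \<in> ?f ` ?S"
    then obtain x where x: "x \<in> ?S" and y: "y = ?f x"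
      by blast
    have "(\<Sum>j\<in>UNIV. y $ j) = (\<Sum>j\<in>UNIV. ?a $ j) + r * (\<Sum>j\<in>UNIV. x $ j)"
      by (simp add: y sum.distrib sum_distrib_left)
    also have "\<dots> = c"
      using x unfolding sum_a by (simp add: nonneg_sum_surface_def rc)
    finally show "y \<in> ?L"
      using x r assms(1) by (auto simp: y nonneg_sum_surface_def)
  qed
qed

section \<open>Corner probabilities under the uniform distribution\<close>

lemma uniformly_distributed_on_surface_pos_finite:
  assumes "prob_space M" "uniformly_distributed_on_surface M X d S"
  shows "hausdorff_measure d S \<noteq> 0" "hausdorff_measure d S < top"
proof -
  interpret prob_space M by fact
  \<comment> \<open>The whole space has probability 1. In \<open>ennreal\<close> both 0 / 0 and
    \<open>top / top\<close> are 0, so this equation rules out both degenerate areas.\<close>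
  have *: "hausdorff_measure d S / hausdorff_measure d S = 1"
    using assms(2) emeasure_space_1
    by (auto simp: uniformly_distributed_on_surface_def dest: bspec [of _ _ UNIV])
  show "hausdorff_measure d S \<noteq> 0"
    using * by auto
  show "hausdorff_measure d S < top"
    using * by (cases "hausdorff_measure d S = top") (simp_all add: less_top)
qed

context
  fixes M :: "'a measure" and X :: "'a \<Rightarrow> real ^ 'm::finite" and d :: nat and c :: real
  assumes M: "prob_space M"
    and unif: "uniformly_distributed_on_surface M X d (nonneg_sum_surface c)"
begin

interpretation prob_space M by (rule M)

lemma measurable_uniformly_distributed [measurable]: "X \<in> borel_measurable M"
  using unif by (simp add: uniformly_distributed_on_surface_def)

lemma prob_corner_ge:
  assumes "0 \<le> t" "real (card J) * t < c"
  shows "prob {\<omega>\<in>space M. \<forall>j\<in>J. t \<le> X \<omega> $ j} = (1 - real (card J) * t / c) ^ d"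
proof -
  let ?S = "nonneg_sum_surface c :: (real ^ 'm) set"
  let ?A = "{y :: real ^ 'm. \<forall>j\<in>J. t \<le> y $ j}"
  let ?r = "1 - real (card J) * t / c"
  have "0 < c"
    using assms by (meson le_less_trans mult_nonneg_nonneg of_nat_0_le_iff)
  then have r: "0 < ?r"
    using assms(2) by simp
  note H = uniformly_distributed_on_surface_pos_finite [OF M unif]
  have A: "?A \<in> sets borel"
    by measurable
  have "emeasure M (X -` ?A \<inter> space M) = hausdorff_measure d (?A \<inter> ?S) / hausdorff_measure d ?S"
    using unif A unfolding uniformly_distributed_on_surface_def by blast
  \<comment> \<open>The area of the simplex is never computed: it factors out of the numerator and
    cancels, being positive and finite.\<close>
  also have "\<dots> = ennreal (?r ^ d) * (hausdorff_measure d ?S / hausdorff_measure d ?S)"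
    using assms r
    by (simp add: nonneg_sum_surface_corner hausdorff_measure_similarity ennreal_times_divide)
  also have "\<dots> = ennreal (?r ^ d)"
    using H by simp
  finally have "prob (X -` ?A \<inter> space M) = ?r ^ d"
    using r by (simp add: measure_def)
  also have "X -` ?A \<inter> space M = {\<omega>\<in>space M. \<forall>j\<in>J. t \<le> X \<omega> $ j}"
    by auto
  finally show ?thesis .
qed

text \<open>The closed corner gives the upper bound. For the lower bound, the closed corners at
  levels \<open>u > t\<close> lie in the open corner at \<open>t\<close>, and their probabilities
  are continuous in \<open>u\<close>. No separate argument that the boundary is null is
  required.\<close>

lemma prob_corner_gt:
  assumes t: "0 \<le> t" "real (card J) * t < c"
  shows "prob {\<omega>\<in>space M. \<forall>j\<in>J. t < X \<omega> $ j} = (1 - real (card J) * t / c) ^ d"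
proof (rule antisym)
  have "prob {\<omega>\<in>space M. \<forall>j\<in>J. t < X \<omega> $ j} \<le> prob {\<omega>\<in>space M. \<forall>j\<in>J. t \<le> X \<omega> $ j}"
    by (intro finite_measure_mono) (auto simp: less_imp_le)
  then show "prob {\<omega>\<in>space M. \<forall>j\<in>J. t < X \<omega> $ j} \<le> (1 - real (card J) * t / c) ^ d"
    using prob_corner_ge [OF t] by simp
next
  have "((\<lambda>u. (1 - real (card J) * u / c) ^ d) \<longlongrightarrow> (1 - real (card J) * t / c) ^ d) (at_right t)"
    unfolding divide_inverse by (intro tendsto_intros)
  moreover have "\<forall>\<^sub>F u in at_right t. (1 - real (card J) * u / c) ^ d
      \<le> prob {\<omega>\<in>space M. \<forall>j\<in>J. t < X \<omega> $ j}"
  proof -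
    have "((\<lambda>u. real (card J) * u) \<longlongrightarrow> real (card J) * t) (at_right t)"
      by (intro tendsto_intros)
    \<comment> \<open>\<open>prob_corner_ge\<close> at level \<open>u\<close> demands this; the
      strict inequality at \<open>t\<close> survives for \<open>u\<close> close to
      \<open>t\<close>.\<close>
    then have "\<forall>\<^sub>F u in at_right t. real (card J) * u < c"
      using t(2) by (rule order_tendstoD)
    with eventually_at_right_less [of t] show ?thesis
    proof eventually_elim
      case (elim u)
      have "prob {\<omega>\<in>space M. \<forall>j\<in>J. u \<le> X \<omega> $ j} \<le> prob {\<omega>\<in>space M. \<forall>j\<in>J. t < X \<omega> $ j}"
        using elim by (intro finite_measure_mono) (auto intro: less_le_trans)
      then show ?case
        using prob_corner_ge [of u J] elim t by simp
    qed
  qed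
  ultimately show "(1 - real (card J) * t / c) ^ d \<le> prob {\<omega>\<in>space M. \<forall>j\<in>J. t < X \<omega> $ j}"
    by (rule tendsto_upperbound) simp
qed

text \<open>Nonnegative coordinates with sum \<open>c\<close> are each at most \<open>c\<close>, so
  the complementary event contains the whole surface. This covers the case \<open>m = 1\<close>,
  where the threshold lies beyond the simplex.\<close>

lemma prob_coordinate_gt_eq_0:
  assumes "c \<le> t"
  shows "prob {\<omega>\<in>space M. t < X \<omega> $ j} = 0"
proof -
  let ?S = "nonneg_sum_surface c :: (real ^ 'm) set"
  let ?A = "{y :: real ^ 'm. y $ j \<le> t}"
  have A: "?A \<in> sets borel"
    by measurable
  have "y $ j \<le> t" if "y \<in> ?S" for y
  proof -
    have "y $ j \<le> (\<Sum>i\<in>UNIV. y $ i)"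
      using that by (intro member_le_sum) (auto simp: nonneg_sum_surface_def)
    then show ?thesis
      using that assms by (simp add: nonneg_sum_surface_def)
  qed
  then have "?A \<inter> ?S = ?S"
    by auto
  then have "emeasure M (X -` ?A \<inter> space M) = hausdorff_measure d ?S / hausdorff_measure d ?S"
    using unif A unfolding uniformly_distributed_on_surface_def by metis
  also have "\<dots> = 1"
    using uniformly_distributed_on_surface_pos_finite [OF M unif] by simp
  finally have 1: "prob (X -` ?A \<inter> space M) = 1"
    by (simp add: measure_def)
  have "{\<omega>\<in>space M. t < X \<omega> $ j} = space M - (X -` ?A \<inter> space M)"
    by auto
  then show ?thesis
    using 1 A by (simp add: prob_compl measurable_sets [OF measurable_uniformly_distributed])
qed

end

section \<open>Variance of a count from single and pair probabilities\<close>

text \<open>\<open>N\<close> is \<open>m\<close> minus the number \<open>Y\<close> of events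
  \<open>G j\<close> that occur, and so has the same variance as \<open>Y\<close>. The second moment
  of \<open>Y\<close> is the sum of all pair probabilities.\<close>

lemma (in prob_space) variance_count_complement:
  fixes G :: "'m::finite \<Rightarrow> 'a set"
  assumes [measurable]: "\<And>j. G j \<in> events"
    and p: "\<And>j. prob (G j) = p"
    and q: "\<And>i j. i \<noteq> j \<Longrightarrow> prob (G i \<inter> G j) = q"
    and N: "\<And>\<omega>. \<omega> \<in> space M \<Longrightarrow> N \<omega> = (\<Sum>j\<in>UNIV. 1 - indicator (G j) \<omega>)"
  defines "m \<equiv> real CARD('m)"
  shows "variance N = m * (p - p\<^sup>2) + m * (m - 1) * (q - p\<^sup>2)"
proof -
  define Y :: "'a \<Rightarrow> real" where "Y \<omega> = (\<Sum>j\<in>UNIV. indicator (G j) \<omega>)" for \<omega>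
  have Y_sq: "(Y \<omega>)\<^sup>2 = (\<Sum>i\<in>UNIV. \<Sum>j\<in>UNIV. indicator (G i \<inter> G j) \<omega> :: real)" for \<omega>
    by (simp add: Y_def power2_eq_square sum_product indicator_inter_arith)
  have int_G: "integrable M (indicator (G j) :: _ \<Rightarrow> real)"
    and int_GG: "integrable M (indicator (G i \<inter> G j) :: _ \<Rightarrow> real)" for i j
    by (auto intro!: integrable_real_indicator simp: less_top [symmetric])
  have Y1: "integrable M Y"
    unfolding Y_def by (intro Bochner_Integration.integrable_sum int_G)
  have Y2: "integrable M (\<lambda>\<omega>. (Y \<omega>)\<^sup>2)"
    unfolding Y_sq by (intro Bochner_Integration.integrable_sum int_GG)
  have EY: "expectation Y = m * p"
    unfolding Y_def using int_G by (simp add: p m_def)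
  have "expectation (\<lambda>\<omega>. (Y \<omega>)\<^sup>2) = (\<Sum>i\<in>UNIV. \<Sum>j\<in>UNIV. prob (G i \<inter> G j))"
    unfolding Y_sq using int_GG by simp
  also have "\<dots> = (\<Sum>i\<in>(UNIV :: 'm set). p + (m - 1) * q)"
  proof (intro sum.cong refl)
    fix i :: 'm
    \<comment> \<open>The diagonal term is \<open>p\<close>; each of the other \<open>m - 1\<close>
      terms is \<open>q\<close>.\<close>
    have "(\<Sum>j\<in>UNIV. prob (G i \<inter> G j)) = prob (G i \<inter> G i) + (\<Sum>j\<in>UNIV - {i}. prob (G i \<inter> G j))"
      by (intro sum.remove) auto
    also have "\<dots> = p + (\<Sum>j\<in>UNIV - {i}. q)"
      by (simp add: p q)
    also have "\<dots> = p + (m - 1) * q"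
      by (simp add: m_def of_nat_diff Suc_le_eq)
    finally show "(\<Sum>j\<in>UNIV. prob (G i \<inter> G j)) = p + (m - 1) * q" .
  qed
  also have "\<dots> = m * (p + (m - 1) * q)"
    by (simp add: m_def)
  finally have EY2: "expectation (\<lambda>\<omega>. (Y \<omega>)\<^sup>2) = m * (p + (m - 1) * q)" .
  have N_Y: "N \<omega> = m - Y \<omega>" if "\<omega> \<in> space M" for \<omega>
    using N [OF that] by (simp add: Y_def m_def sum_subtractf)
  have "expectation N = expectation (\<lambda>\<omega>. m - Y \<omega>)"
    by (intro Bochner_Integration.integral_cong) (auto simp: N_Y)
  also have "\<dots> = m - expectation Y"
    using Y1 by (simp add: prob_space)
  finally have EN: "expectation N = m - expectation Y" .
  have "variance N = variance Y"
    by (intro Bochner_Integration.integral_cong) (auto simp: N_Y EN power2_commute)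
  also have "\<dots> = m * (p + (m - 1) * q) - (m * p)\<^sup>2"
    using variance_eq [OF Y1 Y2] by (simp add: EY EY2)
  \<comment> \<open>The square of \<open>m\<close> is split as \<open>m + m * (m - 1)\<close>, so
    that \<open>p\<^sup>2\<close> is shared between diagonal and off-diagonal pairs.\<close>
  also have "\<dots> = m * (p - p\<^sup>2) + m * (m - 1) * (q - p\<^sup>2)"
    by (simp add: algebra_simps power2_eq_square)
  finally show ?thesis .
qed

section \<open>The threshold and the final computation\<close>

text \<open>The margin is thin, since exp 3 is about 20.09; the first twelve terms of the
  exponential series already exceed 20. The bound is what makes pairs work from \<open>m = 6\<close>
  on.\<close>

lemma ln_20_less_3: "ln (20 :: real) < 3"
proof -
  have "(20 :: real) < (\<Sum>n<12. 3 ^ n / fact n)"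
    by (simp add: lessThan_nat_numeral fact_numeral)
  also have "\<dots> \<le> exp 3"
    using sum_le_suminf [OF summable_exp [of "3 :: real"], of "{..<12}"]
    by (simp add: exp_def divide_inverse mult.commute)
  finally show ?thesis
    by (metis exp_less_cancel_iff exp_ln zero_less_numeral)
qed

text \<open>The pair formula needs \<open>2 * T\<^sup>2\<close> below the coordinate sum, that is,
  \<open>m\<close> above 2 ln 20, about 5.99. For \<open>m\<close> from 2 to 5 two squares cannot
  both exceed \<open>T\<^sup>2\<close>, while
  \<open>(1 - T\<^sup>2 / (real m)\<^sup>2) ^ (m - 1)\<close> is nonzero; hence the excluded values
  of \<open>n\<close>.\<close>

theorem mainTheorem1:
  fixes M :: "'a measure"
    and n m :: nat
    and T :: real
    and absf :: "'m::finite \<Rightarrow> 'a \<Rightarrow> real"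
    and F :: "'m \<Rightarrow> 'a \<Rightarrow> real"
    and N\<^sub>1 :: "'a \<Rightarrow> real"
  assumes "prob_space M"
    and "even n" and "0 < n" and "n \<notin> {4, 6, 8, 10}"
    and "m = n div 2" and "CARD('m) = m"
    and "T = sqrt (- real n * ln 0.05)"
    and "\<And>j. absf j \<in> borel_measurable M"
    and "\<And>j \<omega>. \<omega> \<in> space M \<Longrightarrow> 0 \<le> absf j \<omega>"
    and "uniformly_distributed_on_surface M (\<lambda>\<omega>. \<chi> j. (absf j \<omega>)\<^sup>2) (m - 1)
           (nonneg_sum_surface (2 * (real m)\<^sup>2))"
    and "\<And>j \<omega>. F j \<omega> = (if absf j \<omega> \<le> T then 1 else 0)"
    and "\<And>\<omega>. N\<^sub>1 \<omega> = (\<Sum>j\<in>UNIV. F j \<omega>)"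
  shows "prob_space.variance M N\<^sub>1 =
           real m * ((1 - T\<^sup>2 / (2 * (real m)\<^sup>2)) ^ (m - 1)
                     - (1 - T\<^sup>2 / (2 * (real m)\<^sup>2)) ^ (2 * m - 2))
         + real m * (real m - 1) * ((1 - T\<^sup>2 / (real m)\<^sup>2) ^ (m - 1)
                     - (1 - T\<^sup>2 / (2 * (real m)\<^sup>2)) ^ (2 * m - 2))"
proof -
  interpret prob_space M by fact
  note M = assms(1) and T = assms(7) and [measurable] = assms(8) and nonneg = assms(9)
    and unif = assms(10) and F = assms(11) and N = assms(12)
  \<comment> \<open>The complement of \<open>F j = 1\<close>, phrased with squares because the
    uniform law is that of the squares.\<close>
  define G where "G j = {\<omega>\<in>space M. T\<^sup>2 < (absf j \<omega>)\<^sup>2}" for j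
  define c where "c = 2 * (real m)\<^sup>2"
  have m: "real n = 2 * real m" "1 \<le> m"
    using assms(2,3,5) by auto
  have "ln (0.05 :: real) = - ln 20"
    by (simp add: ln_div)
  then have T_eq: "T = sqrt (2 * real m * ln 20)"
    using T m(1) by (metis minus_mult_minus)
  then have T2: "T\<^sup>2 = 2 * real m * ln 20" and "0 \<le> T"
    by simp_all
  have G: "G j \<in> events" for j
    unfolding G_def by measurable
  have N_G: "N\<^sub>1 \<omega> = (\<Sum>j\<in>UNIV. 1 - indicator (G j) \<omega>)" if "\<omega> \<in> space M" for \<omega>
    unfolding N
  proof (intro sum.cong refl)
    fix j
    have "absf j \<omega> \<le> T \<longleftrightarrow> (absf j \<omega>)\<^sup>2 \<le> T\<^sup>2"
      using \<open>0 \<le> T\<close> nonneg [OF that] by (simp add: power_mono_iff)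
    then show "F j \<omega> = 1 - indicator (G j) \<omega>"
      using that by (simp add: F G_def indicator_def not_le [symmetric])
  qed
  show ?thesis
  proof (cases "m = 1")
    case True
    \<comment> \<open>Here \<open>c = 2\<close> and \<open>T\<^sup>2 = 2 * ln 20\<close>. All
      exceedance probabilities vanish, and on the other side the exponents \<open>m - 1\<close> and
      \<open>2 * m - 2\<close> are 0, so both sides are 0.\<close>
    then have "c \<le> T\<^sup>2"
      using ln_ge_iff [of 20 1] exp_le by (simp add: T2 c_def)
    then have p: "prob (G j) = 0" for j
      using prob_coordinate_gt_eq_0 [OF M unif, of "T\<^sup>2" j] by (simp add: c_def G_def)
    have "prob (G i \<inter> G j) = 0" for i j
      using finite_measure_mono [of "G i \<inter> G j" "G i"] G p [of i]
      by (simp add: measure_le_0_iff)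
    from variance_count_complement [where N = N\<^sub>1, OF G p this N_G] True assms(6) show ?thesis
      by simp
  next
    case False
    have "6 \<le> m"
      using False m(2) assms(2,4,5) by (auto elim!: evenE)
    have "2 * T\<^sup>2 < c"
    proof -
      \<comment> \<open>\<open>2 * T\<^sup>2\<close> is \<open>4 * m * ln 20\<close>, and
        \<open>12 * m\<close> is at most \<open>2 * m\<^sup>2\<close> exactly when \<open>m\<close>
        is at least 6.\<close>
      have "2 * T\<^sup>2 < 12 * real m"
        using ln_20_less_3 m(2) by (simp add: T2)
      also have "\<dots> \<le> c"
        using \<open>6 \<le> m\<close> by (simp add: c_def power2_eq_square)
      finally show ?thesis .
    qed
    then have "T\<^sup>2 < c"
      using zero_le_power2 [of T] by linarith
    have p: "prob (G j) = (1 - T\<^sup>2 / c) ^ (m - 1)" for j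
      using prob_corner_gt [OF M unif, of "T\<^sup>2" "{j}"] \<open>T\<^sup>2 < c\<close> by (simp add: c_def G_def)
    \<comment> \<open>With two coordinates the subtracted fraction \<open>2 * T\<^sup>2 / c\<close>
      simplifies to \<open>T\<^sup>2 / m\<^sup>2\<close>.\<close>
    have q: "prob (G i \<inter> G j) = (1 - T\<^sup>2 / (real m)\<^sup>2) ^ (m - 1)" if "i \<noteq> j" for i j
    proof -
      have "G i \<inter> G j = {\<omega>\<in>space M. \<forall>k\<in>{i, j}. T\<^sup>2 < (absf k \<omega>)\<^sup>2}"
        by (auto simp: G_def)
      then show ?thesis
        using prob_corner_gt [OF M unif, of "T\<^sup>2" "{i, j}"] \<open>2 * T\<^sup>2 < c\<close> that
        by (simp add: c_def)
    qed
    \<comment> \<open>Identifies \<open>p\<^sup>2\<close> with the power of exponent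
      \<open>2 * m - 2\<close> in the claim.\<close>
    have "2 * m - 2 = (m - 1) * 2"
      by simp
    then show ?thesis
      using variance_count_complement [where N = N\<^sub>1, OF G p q N_G] assms(6)
      by (simp add: c_def power_mult)
  qed
qed

end
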